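(* Let $\alpha,\beta\in\mathbb{N}$, $r:=\frac{\alpha+\beta}{2}$ and $k:=\frac{|\beta-\alpha|}{2}$. Then $$\operatorname{Exc}\bigl(B(\alpha,\beta)\bigr)=\left\lfloor\frac{\lfloor r\rfloor-k^2}{2}\right\rfloor.$$ Moreover, if $\alpha,\beta$ are both even, then $\operatorname{Exc}\bigl(\hat B(\alpha,\beta)\bigr)=\frac{r-k^2-2}{2}$.
   Context: $X$ is the graph with vertex set $\mathbb{Z}^2$ in which $(x,y)$ and $(x',y')$ are adjacent iff $|x-x'|+|y-y'|=1$. For $A\subset\mathbb{Z}^2$, $\partial A=\{u\in\mathbb{Z}^2\setminus A:\ u \text{ adjacent to some } v\in A\}$. A finite set $A$ is minimal if $|\partial A|\le|\partial C|$ for all $C$ with $|C|=|A|$. The excess of a finite set $A$ is $\operatorname{Exc}(A)=\max\{|A|-|C|:\ C \text{ minimal},\ |\partial C|=|\partial A|\}$. For $\alpha,\beta\in\mathbb{N}$, $B(\alpha,\beta)=\{(x,y): 0\le y-x\le\alpha,\ 0\le y+x\le\beta\}$, and for even $\alpha,\beta$, $\hat B(\alpha,\beta)=\{(x,y): 0\le y-x\le\alpha,\ -1\le y+x\le\beta-1\}$. *)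

theory Defs
  imports Complex_Main
begin

type_synonym vertex = "int \<times> int"

definition adjacent :: "vertex \<Rightarrow> vertex \<Rightarrow> bool" where
  "adjacent u v \<longleftrightarrow> \<bar>fst u - fst v\<bar> + \<bar>snd u - snd v\<bar> = 1"

definition vertex_boundary :: "vertex set \<Rightarrow> vertex set" where
  "vertex_boundary A = {u. u \<notin> A \<and> (\<exists>v\<in>A. adjacent u v)}"

(* The competitors C are required to be finite because card is 0 on infinite sets. *)
definition minimal :: "vertex set \<Rightarrow> bool" where
  "minimal A \<longleftrightarrow> finite A \<and>
     (\<forall>C. finite C \<and> card C = card A \<longrightarrow> card (vertex_boundary A) \<le> card (vertex_boundary C))"

(* The excess is an integer and can be negative. *)
definition Exc :: "vertex set \<Rightarrow> int" where
  "Exc A = Max {int (card A) - int (card C) | C.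
                  minimal C \<and> card (vertex_boundary C) = card (vertex_boundary A)}"

definition B :: "nat \<Rightarrow> nat \<Rightarrow> vertex set" where
  "B \<alpha> \<beta> = {(x, y). 0 \<le> y - x \<and> y - x \<le> int \<alpha> \<and> 0 \<le> y + x \<and> y + x \<le> int \<beta>}"

(* Only meant for even \<alpha> and \<beta>. *)
definition B_hat :: "nat \<Rightarrow> nat \<Rightarrow> vertex set" where
  "B_hat \<alpha> \<beta> = {(x, y). 0 \<le> y - x \<and> y - x \<le> int \<alpha> \<and> - 1 \<le> y + x \<and> y + x \<le> int \<beta> - 1}"

end

theory Submission
  imports Defs
begin

text \<open>
  The largest cardinality of a set whose vertex boundary has at most s + 4 points is
  M(s) = ((s + 2)^2 + 4) div 8, and |A| > M(s - 1) forces at least s + 4 boundary points.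
  For the upper bound, split A into its two parity classes, of sizes a and b.  The neighbourhood of
  a set X is a translate of X + {0, (1,1)} + {0, (1,-1)}; counting the diagonals and antidiagonals
  that meet X gives |N(X)| \<ge> (sqrt |X| + 1)^2.  Neighbours of one class lie in the other, so
  for a \<ge> b the boundary has at least a - b + 2 sqrt a + 1 points, and at least
  2 sqrt a + 2 sqrt b + 2 points if b > 0.  One of the two estimates always suffices.
  Since deleting a topmost point never increases the boundary, all cardinalities up to M(s) are
  attained with boundary at most s + 4, so the smallest minimal set with s + 4 boundary points
  has cardinality M(s - 1) + 1.
\<close>

section \<open>Neighbourhoods as unions of translates\<close>

definition neighbourhood :: "vertex set \<Rightarrow> vertex set" where
  "neighbourhood X = {u. \<exists>v\<in>X. adjacent u v}"

lemma adjacent_iff: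
  "adjacent (x, y) (x', y') \<longleftrightarrow>
     (x = x' + 1 \<and> y = y') \<or> (x = x' - 1 \<and> y = y') \<or> (x = x' \<and> y = y' + 1) \<or> (x = x' \<and> y = y' - 1)"
proof -
  have "\<bar>a\<bar> + \<bar>b\<bar> = 1 \<longleftrightarrow> (\<bar>a\<bar> = 1 \<and> b = 0) \<or> (a = 0 \<and> \<bar>b\<bar> = 1)" for a b :: int
    using abs_ge_zero[of a] abs_ge_zero[of b] by linarith
  moreover have "\<bar>a - b\<bar> = 1 \<longleftrightarrow> a = b + 1 \<or> a = b - 1" for a b :: int by linarith
  ultimately show ?thesis
    by (simp only: adjacent_def fst_conv snd_conv right_minus_eq conj_disj_distribR
      conj_disj_distribL disj_assoc)
qed

lemma vertex_boundary_eq: "vertex_boundary A = neighbourhood A - A"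
  unfolding vertex_boundary_def neighbourhood_def by auto

text \<open>The four unit vectors are (-1,0) plus the sums of subsets of {(1,1), (1,-1)}. This
  factors the neighbourhood into two doublings along diagonal directions and a translation.\<close>

lemma neighbourhood_eq_shifts:
  fixes X :: "vertex set"
  defines "Y \<equiv> X \<union> (\<lambda>(x, y). (x + 1, y + 1)) ` X"
  shows "neighbourhood X = (\<lambda>(x, y). (x - 1, y)) ` (Y \<union> (\<lambda>(x, y). (x + 1, y - 1)) ` Y)"
    (is "_ = ?f ` ?Z")
proof -
  have "(x, y) \<in> neighbourhood X \<longleftrightarrow> (x + 1, y) \<in> ?Z" for x y
  proof -
    have "(x, y) \<in> neighbourhood X \<longleftrightarrow>
        (x + 1, y) \<in> X \<or> (x - 1, y) \<in> X \<or> (x, y + 1) \<in> X \<or> (x, y - 1) \<in> X"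
      unfolding neighbourhood_def by (force simp: adjacent_iff)
    moreover have shift: "(p, q) \<in> (\<lambda>(x, y). (x + c, y + d)) ` S \<longleftrightarrow> (p - c, q - d) \<in> S"
      for p q c d :: int and S
      by force
    have "(x + 1, y) \<in> ?Z \<longleftrightarrow> (x + 1, y) \<in> Y \<or> (x, y + 1) \<in> Y"
      using shift[of "x + 1" y 1 "- 1" Y] by simp
    moreover have "(p, q) \<in> Y \<longleftrightarrow> (p, q) \<in> X \<or> (p - 1, q - 1) \<in> X" for p q
      unfolding Y_def using shift[of p q 1 1 X] by simp
    ultimately show ?thesis by auto
  qed
  moreover have "(x, y) \<in> ?f ` S \<longleftrightarrow> (x + 1, y) \<in> S" for x y and S :: "vertex set" by force
  ultimately show ?thesis by auto
qed

lemma finite_neighbourhood: "finite X \<Longrightarrow> finite (neighbourhood X)"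
  unfolding neighbourhood_eq_shifts by simp

lemma finite_vertex_boundary: "finite A \<Longrightarrow> finite (vertex_boundary A)"
  unfolding vertex_boundary_eq by (simp add: finite_neighbourhood)

section \<open>Lower bound for the size of a neighbourhood\<close>

text \<open>\<open>T\<close> moves points along the fibres of \<open>g\<close> and strictly raises
  \<open>h\<close>. In each fibre that meets \<open>X\<close>, a point of \<open>X\<close> with
  maximal \<open>h\<close> is therefore sent outside \<open>X\<close>, so every such fibre gains a
  new point.\<close>

lemma card_union_shift_ge:
  fixes X :: "'a set" and g :: "'a \<Rightarrow> 'b" and h :: "'a \<Rightarrow> int"
  assumes "finite X" and g: "\<And>v. g (T v) = g v" and h: "\<And>v. h (T v) > h v"
  shows "card X + card (g ` X) \<le> card (X \<union> T ` X)"
proof -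
  have "g ` X \<subseteq> g ` (T ` X - X)"
  proof
    fix c assume "c \<in> g ` X"
    define F where "F = {v \<in> X. g v = c}"
    have F: "finite (h ` F)" "h ` F \<noteq> {}"
      using \<open>c \<in> g ` X\<close> assms(1) unfolding F_def by auto
    obtain v where v: "v \<in> F" "h v = Max (h ` F)" using Max_in[OF F] by (metis imageE)
    have "T v \<notin> X"
    proof
      assume "T v \<in> X"
      hence "T v \<in> F" using v(1) g unfolding F_def by auto
      hence "h (T v) \<le> h v" using F v(2) by simp
      thus False using h[of v] by simp
    qed
    hence "T v \<in> T ` X - X" "g (T v) = c" using v(1) g unfolding F_def by auto
    thus "c \<in> g ` (T ` X - X)" by blast
  qed
  hence "card (g ` X) \<le> card (T ` X - X)"
    using assms(1) by (meson surj_card_le finite_Diff finite_imageI)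
  moreover have "card (X \<union> T ` X) = card X + card (T ` X - X)"
    using assms(1) card_Un_disjoint[of X "T ` X - X"] by auto
  ultimately show ?thesis by simp
qed

text \<open>Doubling along (1,1) preserves \<open>p\<close> and gains a point for each value of
  \<open>p\<close> on \<open>X\<close>; doubling along (1,-1) preserves \<open>q\<close> and gains
  one for each value of \<open>q\<close> on \<open>Y\<close>. Since \<open>(p, q)\<close> is
  injective, the product of the numbers of values on \<open>X\<close> is at least |X|, and the AM-GM
  inequality bounds their sum.\<close>

lemma card_neighbourhood_ge:
  assumes "finite X" "X \<noteq> {}"
  shows "real (card X) + 2 * sqrt (card X) + 1 \<le> card (neighbourhood X)"
proof -
  define p q :: "vertex \<Rightarrow> int" where "p = (\<lambda>(x, y). y - x)" and "q = (\<lambda>(x, y). x + y)"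
  define Y where "Y = X \<union> (\<lambda>(x, y). (x + 1, y + 1)) ` X"
  define Z where "Z = Y \<union> (\<lambda>(x, y). (x + 1, y - 1)) ` Y"
  have Y: "card X + card (p ` X) \<le> card Y"
    unfolding Y_def by (rule card_union_shift_ge[where h = q]) (use assms in \<open>auto simp: p_def q_def\<close>)
  have "finite Y" using assms unfolding Y_def by simp
  hence Z: "card Y + card (q ` Y) \<le> card Z"
    unfolding Z_def by (intro card_union_shift_ge[where h = "\<lambda>(x, y). x - y"]) (auto simp: q_def)
  have "neighbourhood X = (\<lambda>(x, y). (x - 1, y)) ` Z"
    unfolding Z_def Y_def by (rule neighbourhood_eq_shifts)
  moreover have "inj_on (\<lambda>(x, y). (x - 1, y)) Z" by (auto simp: inj_on_def)
  ultimately have N: "card (neighbourhood X) = card Z" by (simp only: card_image)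
  have "q ` Y = q ` X \<union> (\<lambda>c. c + 2) ` q ` X"
    unfolding Y_def q_def by (auto simp: image_Un image_image split_def add.assoc algebra_simps)
  \<comment> \<open>The counting lemma in dimension one: a constant \<open>g\<close> has a single
    fibre, so the shift by 2 gains at least one value. This is the summand 1 of the bound.\<close>
  moreover have
    "card (q ` X) + card ((\<lambda>_. 0 :: nat) ` q ` X) \<le> card (q ` X \<union> (\<lambda>c. c + 2) ` q ` X)"
    by (rule card_union_shift_ge[where h = id]) (use assms in auto)
  ultimately have q: "card (q ` X) + 1 \<le> card (q ` Y)"
    using assms(2) by (simp add: image_constant_conv)
  have "inj_on (\<lambda>v. (p v, q v)) X" by (auto simp: inj_on_def p_def q_def)
  moreover have "(\<lambda>v. (p v, q v)) ` X \<subseteq> p ` X \<times> q ` X" by auto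
  ultimately have "card X \<le> card (p ` X \<times> q ` X)"
    using assms(1) by (meson card_inj_on_le finite_SigmaI finite_imageI)
  hence "real (card X) \<le> real (card (p ` X)) * real (card (q ` X))"
    by (simp add: card_cartesian_product flip: of_nat_mult)
  hence "sqrt (card X) \<le> sqrt (real (card (p ` X)) * real (card (q ` X)))"
    by (rule real_sqrt_le_mono)
  also have "\<dots> \<le> (real (card (p ` X)) + real (card (q ` X))) / 2"
    by (rule arith_geo_mean_sqrt) simp_all
  finally have "2 * sqrt (card X) \<le> real (card (p ` X) + card (q ` X))" by simp
  moreover have "card X + (card (p ` X) + card (q ` X)) + 1 \<le> card (neighbourhood X)"
    using Y Z N q by linarith
  hence "real (card X + (card (p ` X) + card (q ` X)) + 1) \<le> real (card (neighbourhood X))"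
    by (simp only: of_nat_le_iff)
  ultimately show ?thesis by simp
qed

section \<open>The vertex-isoperimetric inequality\<close>

text \<open>Here \<open>a\<close> and \<open>b\<close> stand for the sizes of the two parity classes
  and \<open>m\<close> for that of the boundary. If the square roots differ by at least 1,
  \<open>large\<close> suffices; otherwise \<open>both\<close> does.\<close>

lemma isoperimetric_arith:
  fixes a b m :: real
  assumes ab: "1 \<le> a" "0 \<le> b" "b \<le> a" "b = 0 \<or> 1 \<le> b"
    and large: "a - b + 2 * sqrt a + 1 \<le> m"
    and both: "1 \<le> b \<Longrightarrow> 2 * sqrt a + 2 * sqrt b + 2 \<le> m"
  shows "2 \<le> m \<and> 8 * (a + b) \<le> (m - 2)\<^sup>2 + 4"
proof -
  define u v where "u = sqrt a" and "v = sqrt b"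
  have uv: "a = u\<^sup>2" "b = v\<^sup>2" "1 \<le> u" "0 \<le> v" "v \<le> u"
    using ab by (auto simp: u_def v_def)
  show ?thesis
  proof (cases "v + 1 \<le> u")
    case True
    \<comment> \<open>In terms of \<open>d\<close>, assumption \<open>large\<close> reads m \<ge> d
      + 4u. Eliminating v through v^2 = (u - 1)^2 - d leaves a difference of the two sides with
      nonnegative coefficients in d and u.\<close>
    define d where "d = (u - 1)\<^sup>2 - v\<^sup>2"
    have "0 \<le> d" using True uv(4) unfolding d_def by (simp add: power_mono)
    have le: "d + 4 * u - 2 \<le> m - 2"
      using large uv(1,2) unfolding d_def u_def[symmetric]
      by (simp add: power2_eq_square algebra_simps)
    hence "(d + 4 * u - 2)\<^sup>2 \<le> (m - 2)\<^sup>2" using \<open>0 \<le> d\<close> uv(3) by (intro power_mono) auto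
    moreover have "8 * (u\<^sup>2 + v\<^sup>2) + (d\<^sup>2 + 8 * (d * u) + 4 * d) = (d + 4 * u - 2)\<^sup>2 + 4"
      unfolding d_def by algebra
    moreover have "0 \<le> d\<^sup>2 + 8 * (d * u) + 4 * d" using \<open>0 \<le> d\<close> uv(3) by simp
    ultimately have "8 * (u\<^sup>2 + v\<^sup>2) \<le> (m - 2)\<^sup>2 + 4" by linarith
    moreover have "2 \<le> m" using le \<open>0 \<le> d\<close> uv(3) by linarith
    ultimately show ?thesis using uv(1,2) by simp
  next
    case False
    hence "b \<noteq> 0" using uv(3) by (auto simp: v_def)
    hence "1 \<le> b" using ab(4) by simp
    have le: "2 * u + 2 * v \<le> m - 2" using both[OF \<open>1 \<le> b\<close>] by (simp add: u_def v_def)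
    hence "(2 * u + 2 * v)\<^sup>2 \<le> (m - 2)\<^sup>2" using uv(3,4) by (intro power_mono) auto
    \<comment> \<open>The additive 4 of the claim absorbs the error 4(u - v)^2, because 0 \<le> u -
      v < 1 in this case.\<close>
    moreover have "8 * (u\<^sup>2 + v\<^sup>2) = (2 * u + 2 * v)\<^sup>2 + 4 * (u - v)\<^sup>2" by algebra
    moreover have "(u - v)\<^sup>2 \<le> 1" using False uv(5) by (simp add: power_le_one)
    ultimately have "8 * (u\<^sup>2 + v\<^sup>2) \<le> (m - 2)\<^sup>2 + 4" by linarith
    moreover have "2 \<le> m" using le uv(3,4) by linarith
    ultimately show ?thesis using uv(1,2) by simp
  qed
qed

text \<open>Neighbours of a point have the opposite parity, so the boundary is the disjoint union of
  N(X) - Y and N(Y) - X. Dropping the second piece yields the hypothesis \<open>large\<close> of the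
  arithmetic lemma, keeping it yields \<open>both\<close>. The flag \<open>e\<close> lets either
  parity be the larger class.\<close>

lemma isoperimetric_split:
  assumes fin: "finite X" "finite Y" and "X \<noteq> {}" and le: "card Y \<le> card X"
    and X: "\<And>x y. (x, y) \<in> X \<Longrightarrow> even (x + y) = e"
    and Y: "\<And>x y. (x, y) \<in> Y \<Longrightarrow> even (x + y) = (\<not> e)"
  shows "2 \<le> card (vertex_boundary (X \<union> Y)) \<and>
    8 * real (card (X \<union> Y)) \<le> (real (card (vertex_boundary (X \<union> Y))) - 2)\<^sup>2 + 4"
proof -
  let ?m = "card (vertex_boundary (X \<union> Y))"
  have NX: "even (x + y) = (\<not> e)" if "(x, y) \<in> neighbourhood X" for x y
    using that X unfolding neighbourhood_def by (fastforce simp: adjacent_iff)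
  have NY: "even (x + y) = e" if "(x, y) \<in> neighbourhood Y" for x y
    using that Y unfolding neighbourhood_def by (fastforce simp: adjacent_iff)
  have "X \<inter> Y = {}" using X Y by (metis disjoint_iff surj_pair)
  hence card: "card (X \<union> Y) = card X + card Y" using fin by (simp add: card_Un_disjoint)
  have "X \<inter> neighbourhood X = {}" "Y \<inter> neighbourhood Y = {}"
    using X NX Y NY by (metis disjoint_iff surj_pair)+
  hence bd: "vertex_boundary (X \<union> Y) = (neighbourhood X - Y) \<union> (neighbourhood Y - X)"
    unfolding vertex_boundary_eq by (auto simp: neighbourhood_def)
  have "(neighbourhood X - Y) \<inter> (neighbourhood Y - X) = {}"
    using NX NY by (metis DiffD1 disjoint_iff surj_pair)
  hence "?m = card (neighbourhood X - Y) + card (neighbourhood Y - X)"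
    unfolding bd using fin by (simp add: card_Un_disjoint finite_neighbourhood)
  moreover have "card (neighbourhood X) - card Y \<le> card (neighbourhood X - Y)"
    "card (neighbourhood Y) - card X \<le> card (neighbourhood Y - X)"
    using fin by (simp_all add: diff_card_le_card_Diff)
  ultimately have m: "card (neighbourhood X) \<le> ?m + card Y"
    "card (neighbourhood X) + card (neighbourhood Y) \<le> ?m + card Y + card X"
    by linarith+
  hence m': "real (card (neighbourhood X)) \<le> real ?m + real (card Y)"
    "real (card (neighbourhood X)) + real (card (neighbourhood Y))
       \<le> real ?m + real (card Y) + real (card X)"
    by (simp_all flip: of_nat_add)
  have "1 \<le> card X" using fin \<open>X \<noteq> {}\<close> by (simp add: Suc_le_eq card_gt_0_iff)
  have "2 \<le> real ?m \<and> 8 * (real (card X) + real (card Y)) \<le> (real ?m - 2)\<^sup>2 + 4"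
  proof (rule isoperimetric_arith)
    show "real (card X) - real (card Y) + 2 * sqrt (card X) + 1 \<le> real ?m"
      using card_neighbourhood_ge[OF fin(1) \<open>X \<noteq> {}\<close>] m' by linarith
    show "2 * sqrt (card X) + 2 * sqrt (card Y) + 2 \<le> real ?m" if "1 \<le> real (card Y)"
    proof -
      have "Y \<noteq> {}" using that by auto
      thus ?thesis
        using card_neighbourhood_ge[OF fin(1) \<open>X \<noteq> {}\<close>] card_neighbourhood_ge[OF fin(2)] m'
        by fastforce
    qed
  qed (use le \<open>1 \<le> card X\<close> in \<open>auto simp: Suc_le_eq\<close>)
  thus ?thesis using card by simp
qed

text \<open>The bound by 2 accompanies the quadratic one because (m - 2)^2 is increasing only from m
  = 2 on; together they turn an upper bound on the boundary into one on |A|.\<close>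

theorem vertex_isoperimetric:
  assumes "finite A" "A \<noteq> {}"
  shows "2 \<le> card (vertex_boundary A)"
    and "8 * int (card A) \<le> (int (card (vertex_boundary A)) - 2)\<^sup>2 + 4"
proof -
  define X Y where "X = {(x, y) \<in> A. even (x + y)}" and "Y = {(x, y) \<in> A. odd (x + y)}"
  have fin: "finite X" "finite Y" and A: "A = X \<union> Y"
    using assms unfolding X_def Y_def by (auto intro: finite_subset)
  have "2 \<le> card (vertex_boundary A) \<and>
    8 * real (card A) \<le> (real (card (vertex_boundary A)) - 2)\<^sup>2 + 4"
  proof (cases "card Y \<le> card X")
    case True
    hence "X \<noteq> {}" using assms fin A by (auto simp: card_eq_0_iff)
    thus ?thesis unfolding A
      by (intro isoperimetric_split[where e = True] fin True) (auto simp: X_def Y_def)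
  next
    case False
    hence "Y \<noteq> {}" by auto
    moreover have "A = Y \<union> X" using A by auto
    moreover have "card X \<le> card Y" using False by simp
    ultimately show ?thesis
      using isoperimetric_split[of Y X False] fin unfolding X_def Y_def by auto
  qed
  moreover have "real_of_int (8 * int (card A)) = 8 * real (card A)"
    "real_of_int ((int (card (vertex_boundary A)) - 2)\<^sup>2 + 4)
       = (real (card (vertex_boundary A)) - 2)\<^sup>2 + 4" by simp_all
  ultimately show "2 \<le> card (vertex_boundary A)"
    "8 * int (card A) \<le> (int (card (vertex_boundary A)) - 2)\<^sup>2 + 4"
    by (simp_all only: flip: of_int_le_iff[where 'a = real])
qed

section \<open>Deleting points without enlarging the boundary\<close>

text \<open>When a topmost point is deleted, only that point can enter the boundary. The point
  directly above leaves it, since its other three neighbours lie above the top row.\<close>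

lemma remove_top_vertex:
  assumes "finite A" "A \<noteq> {}"
  obtains v where "v \<in> A" "card (vertex_boundary (A - {v})) \<le> card (vertex_boundary A)"
proof -
  have "finite (snd ` A)" "snd ` A \<noteq> {}" using assms by auto
  from Max_in[OF this] obtain u where "Max (snd ` A) = snd u" "u \<in> A" by (rule imageE)
  then obtain x y where v: "(x, y) \<in> A" "y = Max (snd ` A)" by (cases u) simp
  have top: "y' \<le> y" if "(x', y') \<in> A" for x' y'
    using that \<open>finite (snd ` A)\<close> v(2) by (metis Max_ge image_eqI snd_conv)
  let ?w = "(x, y + 1)"
  have w: "?w \<in> vertex_boundary A"
    using v(1) top unfolding vertex_boundary_def by (force simp: adjacent_iff)
  have w': "?w \<notin> vertex_boundary (A - {(x, y)})"
    using top unfolding vertex_boundary_def by (fastforce simp: adjacent_iff)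
  have sub: "vertex_boundary (A - {(x, y)}) \<subseteq> insert (x, y) (vertex_boundary A - {?w})"
    using w' unfolding vertex_boundary_def by auto
  have "card (vertex_boundary (A - {(x, y)})) \<le> card (insert (x, y) (vertex_boundary A - {?w}))"
    using assms(1) by (intro card_mono sub) (simp add: finite_vertex_boundary)
  also have "\<dots> \<le> Suc (card (vertex_boundary A - {?w}))"
    by (rule card_insert_le_m1) simp_all
  also have "\<dots> = card (vertex_boundary A)"
    using w assms(1) by (simp only: card_Suc_Diff1 finite_vertex_boundary)
  finally show ?thesis using that v(1) by blast
qed

lemma shrink_vertex_set:
  assumes "finite A" "n \<le> card A"
  shows "\<exists>C. finite C \<and> card C = n \<and> card (vertex_boundary C) \<le> card (vertex_boundary A)"
  using assms
proof (induction "card A" arbitrary: A)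
  case 0
  thus ?case by (intro exI[of _ A]) simp
next
  case (Suc l)
  show ?case
  proof (cases "n = card A")
    case True
    thus ?thesis using Suc.prems by blast
  next
    case False
    have "A \<noteq> {}" using Suc.hyps(2) by auto
    then obtain v where v: "v \<in> A" "card (vertex_boundary (A - {v})) \<le> card (vertex_boundary A)"
      using remove_top_vertex Suc.prems(1) by blast
    have "card (A - {v}) = l" using v(1) Suc by simp
    moreover have "n \<le> l" using False Suc.prems Suc.hyps(2) by simp
    ultimately obtain C where "finite C" "card C = n"
      "card (vertex_boundary C) \<le> card (vertex_boundary (A - {v}))"
      using Suc.hyps(1)[of "A - {v}"] Suc.prems(1) by auto
    thus ?thesis using v(2) le_trans by blast
  qed
qed

section \<open>Sizes and boundaries of boxes\<close>

text \<open>The sets B and B-hat are the cases c = 0 and c = -1.\<close>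

definition box :: "nat \<Rightarrow> int \<Rightarrow> nat \<Rightarrow> vertex set" where
  "box \<alpha> c \<beta> = {(x, y). 0 \<le> y - x \<and> y - x \<le> int \<alpha> \<and> c \<le> y + x \<and> y + x \<le> c + int \<beta>}"

lemma box_0:
  "finite (box \<alpha> c 0) \<and> card (box \<alpha> c 0) = (\<alpha> + 1 + of_bool (even c)) div 2"
proof -
  \<comment> \<open>On the antidiagonal y + x = c the condition is 0 \<le> 2y - c \<le> \<alpha>, so
    y runs from the ceiling of c/2 to the floor of (c + \<alpha>)/2.\<close>
  have "box \<alpha> c 0 = (\<lambda>y. (c - y, y)) ` {(c + 1) div 2 .. (c + int \<alpha>) div 2}"
    unfolding box_def by (auto simp: image_iff)
  moreover have "inj (\<lambda>y. (c - y, y))" by (auto simp: inj_def)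
  ultimately have "finite (box \<alpha> c 0)"
    "card (box \<alpha> c 0) = nat ((c + int \<alpha>) div 2 - (c + 1) div 2 + 1)"
    by (simp_all add: card_image inj_on_subset)
  moreover have "(c + int \<alpha>) div 2 - (c + 1) div 2 + 1 = int ((\<alpha> + 1 + of_bool (even c)) div 2)"
  proof (cases "even c")
    case True
    then obtain z where "c = 2 * z" by (metis evenE)
    thus ?thesis by (simp add: zdiv_int)
  next
    case False
    then obtain z where "c = 2 * z + 1" by (metis oddE)
    moreover have "(2 * z + 1 + int \<alpha>) div 2 = z + (int \<alpha> + 1) div 2" by presburger
    ultimately show ?thesis by (simp add: zdiv_int add.commute)
  qed
  ultimately show ?thesis by simp
qed

lemma box_Suc:
  "box \<alpha> c (Suc \<beta>) = box \<alpha> c \<beta> \<union> box \<alpha> (c + int (Suc \<beta>)) 0"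
  unfolding box_def by auto

lemma finite_box: "finite (box \<alpha> c \<beta>)"
  by (induction \<beta>) (use box_0 in \<open>auto simp only: box_Suc finite_Un\<close>)

text \<open>In the coordinates (y - x, y + x) lattice points are the pairs of equal parity, about
  half of the (\<alpha> + 1)(\<beta> + 1) pairs. If this product is odd, the class containing the
  corners is larger by one, and the corners are lattice points exactly when \<open>c\<close> is
  even. The induction adds one antidiagonal at a time.\<close>

lemma card_box: "card (box \<alpha> c \<beta>) = ((\<alpha> + 1) * (\<beta> + 1) + of_bool (even c)) div 2"
proof (induction \<beta>)
  case 0
  thus ?case using box_0 by simp
next
  case (Suc \<beta>)
  have "box \<alpha> c \<beta> \<inter> box \<alpha> (c + int (Suc \<beta>)) 0 = {}" unfolding box_def by auto
  hence "card (box \<alpha> c (Suc \<beta>)) = card (box \<alpha> c \<beta>) + card (box \<alpha> (c + int (Suc \<beta>)) 0)"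
    unfolding box_Suc by (simp add: card_Un_disjoint finite_box)
  also have "\<dots> = ((\<alpha> + 1) * (\<beta> + 1) + of_bool (even c)) div 2 +
      (\<alpha> + 1 + of_bool (even (c + int (Suc \<beta>)))) div 2"
    using Suc box_0 by simp
  also have "\<dots> = ((\<alpha> + 1) * (Suc \<beta> + 1) + of_bool (even c)) div 2"
  proof (cases "even \<beta>")
    case False
    then obtain z where "\<beta> + 1 = 2 * z" by (metis evenE odd_even_add odd_one)
    thus ?thesis by (auto simp: algebra_simps)
  next
    case True
    then obtain z where z: "\<beta> = 2 * z" by (metis evenE)
    show ?thesis
      by (cases "even c"; cases "even \<alpha>") (auto simp: z algebra_simps elim!: evenE oddE)
  qed
  finally show ?case .
qed

text \<open>Moving down by one lowers y - x and y + x by 1, so the enlarged box is a translate of a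
  box with the same \<open>c\<close>. The rounding terms then agree and the sizes differ by exactly
  \<alpha> + \<beta> + 4.\<close>

lemma card_enlarged_box:
  defines "S \<alpha> c \<beta> \<equiv>
    {(x, y). - 1 \<le> y - x \<and> y - x \<le> int \<alpha> + 1 \<and> c - 1 \<le> y + x \<and> y + x \<le> c + int \<beta> + 1}"
  shows "finite (S \<alpha> c \<beta>)" "box \<alpha> c \<beta> \<subseteq> S \<alpha> c \<beta>"
    "card (S \<alpha> c \<beta> - box \<alpha> c \<beta>) = \<alpha> + \<beta> + 4"
proof -
  have S: "S \<alpha> c \<beta> = (\<lambda>(x, y). (x, y - 1)) ` box (\<alpha> + 2) c (\<beta> + 2)"
  proof -
    have "(x, y) \<in> S \<alpha> c \<beta> \<longleftrightarrow> (x, y + 1) \<in> box (\<alpha> + 2) c (\<beta> + 2)" for x y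
      unfolding S_def box_def by auto
    thus ?thesis by force
  qed
  moreover have "inj (\<lambda>(x, y). (x, y - 1 :: int))" by (auto simp: inj_def)
  ultimately have "card (S \<alpha> c \<beta>) = card (box (\<alpha> + 2) c (\<beta> + 2))"
    by (metis card_image inj_on_subset subset_UNIV)
  moreover have "(\<alpha> + 2 + 1) * (\<beta> + 2 + 1) = (\<alpha> + 1) * (\<beta> + 1) + (\<alpha> + \<beta> + 4) * 2"
    by (simp add: algebra_simps)
  ultimately have "card (S \<alpha> c \<beta>) = card (box \<alpha> c \<beta>) + (\<alpha> + \<beta> + 4)"
    unfolding card_box by simp
  moreover show fin: "finite (S \<alpha> c \<beta>)" unfolding S by (simp add: finite_box)
  moreover show sub: "box \<alpha> c \<beta> \<subseteq> S \<alpha> c \<beta>" unfolding S_def box_def by auto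
  ultimately show "card (S \<alpha> c \<beta> - box \<alpha> c \<beta>) = \<alpha> + \<beta> + 4"
    by (simp add: card_Diff_subset finite_box)
qed

lemma card_vertex_boundary_box_le: "card (vertex_boundary (box \<alpha> c \<beta>)) \<le> \<alpha> + \<beta> + 4"
  unfolding card_enlarged_box(3)[of \<alpha> c \<beta>, symmetric]
  by (intro card_mono finite_Diff card_enlarged_box(1))
    (auto simp: vertex_boundary_def box_def adjacent_iff)

text \<open>A unit step changes y - x and y + x by 1 each, with any choice of signs. Each coordinate
  is raised if it is below its upper limit and lowered otherwise; as both sides have length at least
  1, this leads from the frame into the box. For \<alpha> = 0, \<beta> = 1, c = 0 the box is one
  point with only 4 neighbours.\<close>

lemma card_vertex_boundary_box:
  assumes "1 \<le> \<alpha>" "1 \<le> \<beta>"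
  shows "card (vertex_boundary (box \<alpha> c \<beta>)) = \<alpha> + \<beta> + 4"
proof -
  have "(x, y) \<in> vertex_boundary (box \<alpha> c \<beta>)"
    if "(x, y) \<notin> box \<alpha> c \<beta>" "- 1 \<le> y - x" "y - x \<le> int \<alpha> + 1" "c - 1 \<le> y + x"
      "y + x \<le> c + int \<beta> + 1" for x y
  proof -
    have "(x + 1, y) \<in> box \<alpha> c \<beta> \<or> (x - 1, y) \<in> box \<alpha> c \<beta> \<or>
        (x, y + 1) \<in> box \<alpha> c \<beta> \<or> (x, y - 1) \<in> box \<alpha> c \<beta>"
      using that(2-) assms
      by (cases "y - x < int \<alpha>"; cases "y + x < c + int \<beta>") (simp_all add: box_def)
    moreover have "adjacent (x, y) (x + 1, y)" "adjacent (x, y) (x - 1, y)"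
      "adjacent (x, y) (x, y + 1)" "adjacent (x, y) (x, y - 1)" by (simp_all add: adjacent_iff)
    ultimately show ?thesis using that(1) unfolding vertex_boundary_def by blast
  qed
  hence "\<alpha> + \<beta> + 4 \<le> card (vertex_boundary (box \<alpha> c \<beta>))"
    unfolding card_enlarged_box(3)[of \<alpha> c \<beta>, symmetric]
    by (intro card_mono finite_vertex_boundary finite_box) auto
  thus ?thesis using card_vertex_boundary_box_le[of \<alpha> c \<beta>] by simp
qed

section \<open>The extremal cardinality and the excess\<close>

theorem exists_set_card_vertex_boundary_le_iff:
  "(\<exists>A. finite A \<and> card A = n \<and> card (vertex_boundary A) \<le> s + 4) \<longleftrightarrow>
     n \<le> ((s + 2)\<^sup>2 + 4) div 8"
proof
  assume "\<exists>A. finite A \<and> card A = n \<and> card (vertex_boundary A) \<le> s + 4"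
  then obtain A where A: "finite A" "card A = n" "card (vertex_boundary A) \<le> s + 4" by blast
  show "n \<le> ((s + 2)\<^sup>2 + 4) div 8"
  proof (cases "A = {}")
    case True
    thus ?thesis using A(2) by simp
  next
    case False
    note iso = vertex_isoperimetric[OF A(1) False]
    have "(int (card (vertex_boundary A)) - 2)\<^sup>2 \<le> (int (s + 2))\<^sup>2"
      using A(3) iso(1) by (intro power_mono) auto
    hence "int (8 * card A) \<le> int ((s + 2)\<^sup>2 + 4)" using iso(2) by simp
    hence "8 * card A \<le> (s + 2)\<^sup>2 + 4" by (simp only: of_nat_le_iff)
    thus ?thesis using A(2) by linarith
  qed
next
  assume n: "n \<le> ((s + 2)\<^sup>2 + 4) div 8"
  \<comment> \<open>The most nearly square box with \<alpha> + \<beta> = s, based at c = 0 where the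
    rounding is upward, attains the isoperimetric bound.\<close>
  define \<alpha> \<beta> where "\<alpha> = s div 2" and "\<beta> = (s + 1) div 2"
  have s: "\<alpha> + \<beta> = s" unfolding \<alpha>_def \<beta>_def by presburger
  have "((s + 2)\<^sup>2 + 4) div 8 = ((\<alpha> + 1) * (\<beta> + 1) + 1) div 2"
  proof (cases "even s")
    case True
    hence "\<beta> = \<alpha>" unfolding \<alpha>_def \<beta>_def by presburger
    hence "(s + 2)\<^sup>2 + 4 = 4 * ((\<alpha> + 1) * (\<beta> + 1) + 1)"
      using s by (simp add: power2_eq_square algebra_simps flip: s)
    thus ?thesis by simp
  next
    case False
    hence \<beta>: "\<beta> = \<alpha> + 1" unfolding \<alpha>_def \<beta>_def by presburger
    have "even ((\<alpha> + 1) * (\<beta> + 1))" using \<beta> by simp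
    then obtain z where z: "(\<alpha> + 1) * (\<beta> + 1) = 2 * z" by (metis evenE)
    have "(s + 2)\<^sup>2 + 4 = 4 * ((\<alpha> + 1) * (\<beta> + 1)) + 5"
      using \<beta> by (simp add: power2_eq_square algebra_simps flip: s)
    thus ?thesis unfolding z by simp
  qed
  hence "n \<le> card (box \<alpha> 0 \<beta>)" using n by (simp add: card_box)
  from shrink_vertex_set[OF finite_box this] obtain C where "finite C" "card C = n"
    "card (vertex_boundary C) \<le> card (vertex_boundary (box \<alpha> 0 \<beta>))"
    by blast
  moreover have "card (vertex_boundary (box \<alpha> 0 \<beta>)) \<le> s + 4"
    using card_vertex_boundary_box_le[of \<alpha> 0 \<beta>] s by simp
  ultimately show "\<exists>A. finite A \<and> card A = n \<and> card (vertex_boundary A) \<le> s + 4"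
    using le_trans by blast
qed

text \<open>A minimal set with s + 5 boundary points has more than M(s) points, since a set of at
  most M(s) points has a competitor of equal size with a smaller boundary. The value M(s) + 1 is
  attained because M(s) < M(s + 1); this needs s \<ge> 1, as M(0) = M(1) = 1.\<close>

lemma Exc_eq:
  assumes A: "card (vertex_boundary A) = s + 5" and "1 \<le> s"
  shows "Exc A = int (card A) - int (((s + 2)\<^sup>2 + 4) div 8) - 1"
proof -
  define M where "M = ((s + 2)\<^sup>2 + 4) div 8"
  define M' where "M' = ((s + 1 + 2)\<^sup>2 + 4) div 8"
  note M = exists_set_card_vertex_boundary_le_iff[where s = s, folded M_def]
  have "s + 1 + 4 = s + 5" by simp
  note M' = exists_set_card_vertex_boundary_le_iff[where s = "s + 1", folded M'_def, unfolded this]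
  have "M + 1 \<le> M'"
  \<comment> \<open>The numerators differ by 2s + 5, which is at least 8 from s = 2 on; for s = 1 it
    is only 7 and the values are computed.\<close>
  proof (cases "s = 1")
    case True
    show ?thesis unfolding M_def M'_def True by (simp add: power2_eq_square)
  next
    case False
    hence "((s + 2)\<^sup>2 + 4) + 8 \<le> (s + 1 + 2)\<^sup>2 + 4"
      using assms(2) by (simp add: power2_eq_square algebra_simps)
    from div_le_mono[OF this, of 8] show ?thesis unfolding M_def M'_def by simp
  qed
  then obtain D where D: "finite D" "card D = M + 1" "card (vertex_boundary D) \<le> s + 5"
    unfolding M'[symmetric] by blast
  have ge: "s + 5 \<le> card (vertex_boundary C)" if "finite C" "card C = M + 1" for C
  proof (rule ccontr)
    assume "\<not> ?thesis"
    hence "card (vertex_boundary C) \<le> s + 4" by simp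
    with that have "\<exists>C. finite C \<and> card C = M + 1 \<and> card (vertex_boundary C) \<le> s + 4" by blast
    hence "M + 1 \<le> M" unfolding M .
    thus False by simp
  qed
  have bd: "card (vertex_boundary D) = s + 5" using ge D by (simp add: le_antisym)
  hence "minimal D" unfolding minimal_def using D ge by simp
  let ?E = "{int (card A) - int (card C) | C.
                  minimal C \<and> card (vertex_boundary C) = card (vertex_boundary A)}"
  have "Max ?E = int (card A) - int M - 1"
  proof (rule Max_eqI)
    \<comment> \<open>\<open>Max\<close> requires a finite set; M(s + 1) bounds the sizes of all
      sets with s + 5 boundary points.\<close>
    have "card C \<le> M'" if "minimal C" "card (vertex_boundary C) = s + 5" for C
      unfolding M'[symmetric] using that unfolding minimal_def by (intro exI[of _ C]) simp
    hence "?E \<subseteq> (\<lambda>n. int (card A) - int n) ` {..M'}" unfolding A by blast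
    thus "finite ?E" by (rule finite_subset) simp
  next
    fix e assume "e \<in> ?E"
    then obtain C where C: "e = int (card A) - int (card C)" "minimal C"
      "card (vertex_boundary C) = s + 5" unfolding A by blast
    have "M < card C"
    proof (rule ccontr)
      assume "\<not> M < card C"
      hence "card C \<le> M" by (rule leI)
      then obtain C' where C': "finite C'" "card C' = card C" "card (vertex_boundary C') \<le> s + 4"
        unfolding M[symmetric] by blast
      have "card (vertex_boundary C) \<le> card (vertex_boundary C')"
        using C(2) C'(1,2) unfolding minimal_def by simp
      thus False using C(3) C'(3) by simp
    qed
    thus "e \<le> int (card A) - int M - 1" using C(1) by linarith
  next
    have "int (card A) - int M - 1 = int (card A) - int (card D)" unfolding D(2) by simp
    thus "int (card A) - int M - 1 \<in> ?E" using \<open>minimal D\<close> bd unfolding A by blast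
  qed
  thus ?thesis unfolding Exc_def M_def .
qed

section \<open>Evaluation of the closed formula\<close>

text \<open>The argument of \<open>e\<close> is the rounding term of the box size: 1 for even
  \<open>c\<close>, as for \<open>B\<close>, and 0 for odd \<open>c\<close>, as for
  \<open>B_hat\<close>. The proof splits by the parity of \<alpha> + \<beta>.\<close>

lemma excess_formula:
  fixes \<alpha> \<beta> :: nat and r k :: real
  assumes "r = (real \<alpha> + real \<beta>) / 2" and "k = \<bar>real \<beta> - real \<alpha>\<bar> / 2"
  defines "e i \<equiv> ((int \<alpha> + 1) * (int \<beta> + 1) + i) div 2
    - ((int \<alpha> + int \<beta> + 1)\<^sup>2 + 4) div 8 - 1"
  shows "e 1 = \<lfloor>(of_int \<lfloor>r\<rfloor> - k\<^sup>2) / 2\<rfloor> \<and>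
    (even \<alpha> \<and> even \<beta> \<longrightarrow> real_of_int (e 0) = (r - k\<^sup>2 - 2) / 2)"
proof -
  have k2: "k\<^sup>2 = ((real \<beta> - real \<alpha>) / 2)\<^sup>2" unfolding assms(2) by (simp add: power_divide)
  show ?thesis
  proof (cases "even (\<alpha> + \<beta>)")
    case True
    then obtain m where m: "\<alpha> + \<beta> = 2 * m" by (rule evenE)
    \<comment> \<open>In the even case \<open>t\<close> is r and \<open>j\<close> is k up to
      sign.\<close>
    define t j where "t = int m" and "j = int m - int \<alpha>"
    have ab: "int \<alpha> = t - j" "int \<beta> = t + j" using m unfolding t_def j_def by linarith+
    hence ab': "real \<alpha> = of_int t - of_int j" "real \<beta> = of_int t + of_int j"
      by (metis of_int_of_nat_eq of_int_diff, metis of_int_of_nat_eq of_int_add)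
    have r: "r = of_int t" and k: "k\<^sup>2 = of_int (j\<^sup>2)" using assms(1) k2 ab' by simp_all
    have "even (t\<^sup>2 + t)" by simp
    then obtain z where z: "t\<^sup>2 + t = 2 * z" by (metis evenE)
    have "(2 * t + 1)\<^sup>2 + 4 = 4 * (t\<^sup>2 + t) + 5" by algebra
    hence M: "((int \<alpha> + int \<beta> + 1)\<^sup>2 + 4) div 8 = z" using z ab by simp
    have P: "(int \<alpha> + 1) * (int \<beta> + 1) = t - j\<^sup>2 + 1 + 2 * z"
      unfolding ab z[symmetric] by algebra
    have "e 1 = (t - j\<^sup>2) div 2" unfolding e_def M P by simp
    moreover have "\<lfloor>(of_int \<lfloor>r\<rfloor> - k\<^sup>2) / 2\<rfloor> = (t - j\<^sup>2) div 2"
      using floor_divide_of_int_eq[of "t - j\<^sup>2" 2, where 'a = real] unfolding r k by simp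
    moreover have "real_of_int (e 0) = (r - k\<^sup>2 - 2) / 2" if "even \<alpha>"
    proof -
      have "even (t - j)" using that ab(1) by (metis even_of_nat)
      hence "even (t - j\<^sup>2)" by simp
      then obtain w where w: "t - j\<^sup>2 = 2 * w" by (metis evenE)
      have "e 0 = w - 1" unfolding e_def M P w by simp
      moreover have "r - k\<^sup>2 = 2 * of_int w"
        unfolding r k using w by (metis of_int_diff of_int_mult of_int_numeral)
      ultimately show ?thesis by simp
    qed
    ultimately show ?thesis by simp
  next
    case False
    then obtain m where m: "\<alpha> + \<beta> = 2 * m + 1" by (rule oddE)
    \<comment> \<open>Now \<beta> - \<alpha> = 2j + 1, so k^2 = j^2 + j + 1/4, and \<open>t\<close>
      is the floor of r.\<close>
    define t j where "t = int m" and "j = int m - int \<alpha>"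
    have ab: "int \<alpha> = t - j" "int \<beta> = t + j + 1" using m unfolding t_def j_def by linarith+
    hence ab': "real \<alpha> = of_int t - of_int j" "real \<beta> = of_int t + of_int j + 1"
      by (metis of_int_of_nat_eq of_int_diff, metis of_int_of_nat_eq of_int_add of_int_1)
    have "r = of_int t + 1 / 2" using assms(1) ab' by (simp add: field_simps)
    hence r: "\<lfloor>r\<rfloor> = t" by linarith
    have k: "k\<^sup>2 = of_int (j\<^sup>2 + j) + 1 / 4"
      unfolding k2 ab' by (simp add: power2_eq_square field_simps)
    have "even (j\<^sup>2 + j)" "even (t\<^sup>2 + t)" by simp_all
    then obtain z y where zy: "j\<^sup>2 + j = 2 * z" "t\<^sup>2 + t = 2 * y" by (metis evenE)
    have "(2 * t + 1 + 1)\<^sup>2 + 4 = 4 * (t\<^sup>2 + t + t + 2)" by algebra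
    moreover have "int \<alpha> + int \<beta> = 2 * t + 1" using ab by simp
    ultimately have M: "((int \<alpha> + int \<beta> + 1)\<^sup>2 + 4) div 8 = (2 * y + t + 2) div 2" using zy by simp
    have P: "(int \<alpha> + 1) * (int \<beta> + 1) = 2 * (y - z + t + 1)"
      using zy unfolding ab by algebra
    have "e 1 = (t - 2 * z - 1) div 2" unfolding e_def M P by simp presburger
    \<comment> \<open>The number t - 2z - 1/4 lies strictly between the integers t - 2z - 1 and t -
      2z, so halving and rounding down gives the same result as for the lower one.\<close>
    moreover have "\<lfloor>(of_int \<lfloor>r\<rfloor> - k\<^sup>2) / 2\<rfloor> = (t - 2 * z - 1) div 2"
    proof (rule floor_unique)
      define d where "d = (t - 2 * z - 1) div 2"
      have d: "2 * d \<le> t - 2 * z - 1" "t - 2 * z \<le> 2 * d + 2" unfolding d_def by presburger+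
      have "real_of_int (2 * d) \<le> of_int (t - 2 * z - 1)" "real_of_int (t - 2 * z) \<le> of_int (2 * d + 2)"
        using d by (simp_all only: of_int_le_iff)
      thus "of_int ((t - 2 * z - 1) div 2) \<le> (of_int \<lfloor>r\<rfloor> - k\<^sup>2) / 2"
        "(of_int \<lfloor>r\<rfloor> - k\<^sup>2) / 2 < of_int ((t - 2 * z - 1) div 2) + 1"
        unfolding r k zy d_def[symmetric] by simp_all
    qed
    ultimately show ?thesis using False by simp
  qed
qed

theorem theorem5p13:
  fixes \<alpha> \<beta> :: nat and r k :: real
  assumes "\<alpha> \<ge> 1" and "\<beta> \<ge> 1"
    and "r = (real \<alpha> + real \<beta>) / 2"
    and "k = \<bar>real \<beta> - real \<alpha>\<bar> / 2"
  shows "Exc (B \<alpha> \<beta>) = \<lfloor>(of_int \<lfloor>r\<rfloor> - k\<^sup>2) / 2\<rfloor> \<and>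
    (even \<alpha> \<and> even \<beta> \<longrightarrow> real_of_int (Exc (B_hat \<alpha> \<beta>)) = (r - k\<^sup>2 - 2) / 2)"
proof -
  \<comment> \<open>Chosen so that the boundary size \<alpha> + \<beta> + 4 of both boxes is s +
    5.\<close>
  define s where "s = \<alpha> + \<beta> - 1"
  have s: "1 \<le> s" "\<alpha> + \<beta> = s + 1" using assms(1,2) by (auto simp: s_def)
  have B: "B \<alpha> \<beta> = box \<alpha> 0 \<beta>" "B_hat \<alpha> \<beta> = box \<alpha> (- 1) \<beta>"
    unfolding B_def B_hat_def box_def by auto
  have "int s = int \<alpha> + int \<beta> - 1" using s(2) by linarith
  hence "int (((s + 2)\<^sup>2 + 4) div 8) = ((int \<alpha> + int \<beta> + 1)\<^sup>2 + 4) div 8"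
    by (simp add: zdiv_int add_ac)
  moreover have "card (vertex_boundary (box \<alpha> c \<beta>)) = s + 5" for c
    using card_vertex_boundary_box[OF assms(1,2)] s(2) by simp
  ultimately have Exc: "Exc (box \<alpha> c \<beta>) = ((int \<alpha> + 1) * (int \<beta> + 1) + of_bool (even c)) div 2
      - ((int \<alpha> + int \<beta> + 1)\<^sup>2 + 4) div 8 - 1" for c
    using Exc_eq[OF _ s(1), of "box \<alpha> c \<beta>"]
    unfolding card_box by (simp add: zdiv_int add.commute mult.commute del: mult_Suc mult_Suc_right)
  show ?thesis using excess_formula[OF assms(3,4)] unfolding B Exc by simp
qed

end
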